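(* Let $p>2$ be a prime and let $n$ be a positive integer. Let $a$ and $b$ be even integers with $0\le a<b\le p-1$. Let $m,s,t$ be positive integers with $1\le m\le n\le s\le t$, and let $i$ be an arbitrary non-negative integer. Then $$\sum_{r=0}^{2^n-1}(-1)^r\genfrac{[}{]}{0pt}{}{k_r^{(s)}/2}{i}_q\genfrac{[}{]}{0pt}{}{\alpha^{(t)}(a,b)-i}{k_r^{(s)}/2}_q\equiv 0 \pmod{\Phi_{p^m}(q)}$$ in $\mathbb{Z}[q]$, where $\Phi_{p^m}(q)$ is the $p^m$-th cyclotomic polynomial and $k_r^{(s)}$, $\alpha^{(t)}(a,b)$ are the integers defined in the context.
   Context: For a non-negative integer $r$ with binary expansion $r=\sum_{j\ge 0} r_j2^j$, $r_j\in\{0,1\}$, set $k_r:=\sum_{j=0}^{\infty}\big((b-a)r_j+a\big)p^j\in\mathbb{Z}_p$, and let $k_r^{(s)}:=\sum_{j=0}^{s-1}\big((b-a)r_j+a\big)p^j\in\mathbb{Z}$ be its truncation to the first $s$ $p$-adic digits. Since $a,b$ are even, $k_r^{(s)}/2$ is a non-negative integer. Set $\alpha(a,b):=\sum_{j=0}^{\infty}\frac{a+b}{2}p^j=\frac{a+b}{2(1-p)}\in\mathbb{Z}_p$ and $\alpha^{(t)}(a,b):=\sum_{j=0}^{t-1}\frac{a+b}{2}p^j\in\mathbb{Z}$. For integers $0\le k\le N$ the $q$-binomial coefficient is $\genfrac{[}{]}{0pt}{}{N}{k}_q=\frac{[N]_q!}{[k]_q!\,[N-k]_q!}\in\mathbb{Z}[q]$,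 where $[N]_q=\frac{1-q^N}{1-q}$ and $[N]_q!=\prod_{j=1}^N[j]_q$, $[0]_q!=1$. More generally, for any integer $N$ and $k\ge0$, $\genfrac{[}{]}{0pt}{}{N}{k}_q=\prod_{j=0}^{k-1}\frac{1-q^{N-j}}{1-q^{j+1}}$; in particular it is $0$ if $0\le N<k$. (If $\alpha^{(t)}(a,b)-i<0$, then $i>k_r^{(s)}/2$, so the first factor in every summand is $0$.) *)

theory Defs
  imports
    "HOL-Computational_Algebra.Computational_Algebra"
    Complex_Main
begin

definition primitive_root_unity :: "nat \<Rightarrow> complex \<Rightarrow> bool" where
  "primitive_root_unity n z \<longleftrightarrow> z ^ n = 1 \<and> (\<forall>d\<in>{1..<n}. z ^ d \<noteq> 1)"

text \<open>
  The description below is justified by the theorem \<open>of_int_cyclotomic\<close>: for positive \<open>n\<close> the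
  product over the primitive \<open>n\<close>-th roots of unity has integer coefficients.
\<close>

definition cyclotomic :: "nat \<Rightarrow> int poly" where
  "cyclotomic n =
     (THE P. map_poly of_int P = (\<Prod>z | primitive_root_unity n z. [:- z, 1:]))"

lemma map_poly_of_int_mult:
  "map_poly of_int (P * Q) = map_poly of_int P * (map_poly of_int Q :: complex poly)"
  by (rule poly_eqI) (simp add: coeff_map_poly coeff_mult)

lemma map_poly_of_int_add:
  "map_poly of_int (P + Q) = map_poly of_int P + (map_poly of_int Q :: complex poly)"
  by (rule poly_eqI) (simp add: coeff_map_poly)

lemma map_poly_of_int_inject:
  "map_poly of_int P = (map_poly of_int Q :: complex poly) \<longleftrightarrow> P = Q"
  by (auto simp: poly_eq_iff coeff_map_poly)

lemma map_poly_of_int_prod: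
  "map_poly of_int (\<Prod>x\<in>A. f x) = (\<Prod>x\<in>A. map_poly of_int (f x) :: complex poly)"
  by (induction A rule: infinite_finite_induct) (simp_all add: map_poly_of_int_mult)

lemma prod_roots_unity:
  assumes "n > 0"
  shows "(\<Prod>z | z ^ n = 1. [:- z, 1:]) = (monom 1 n - 1 :: complex poly)"
proof -
  let ?p = "monom 1 n - 1 :: complex poly"
  have root: "poly ?p z = 0 \<longleftrightarrow> z ^ n = 1" for z
    by (simp add: poly_monom)
  have "coeff ?p n = 1"
    using assms by simp
  moreover have "degree ?p = n"
  proof (rule antisym)
    show "degree ?p \<le> n"
      by (rule degree_diff_le) (auto simp: degree_monom_le)
    show "n \<le> degree ?p"
      using \<open>coeff ?p n = 1\<close> by (intro le_degree) simp
  qed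
  ultimately have lc: "lead_coeff ?p = 1"
    by simp
  have "rsquarefree ?p"
    using assms
    by (auto simp: rsquarefree_roots poly_monom pderiv_diff pderiv_monom power_0_left)
  from complex_poly_decompose_rsquarefree[OF this] show ?thesis
    unfolding lc root by simp
qed

lemma roots_unity_partition:
  assumes "n > 0"
  shows "{z. z ^ n = 1} = (\<Union>d\<in>{d. d dvd n}. {z. primitive_root_unity d z})"
proof (intro equalityI subsetI)
  fix z :: complex assume "z \<in> {z. z ^ n = 1}"
  hence zn: "z ^ n = 1" by simp
  define d where "d = (LEAST d. d > 0 \<and> z ^ d = 1)"
  have d: "d > 0 \<and> z ^ d = 1"
    unfolding d_def by (rule LeastI[of _ n]) (use zn assms in auto)
  have least: "z ^ e \<noteq> 1" if "e > 0" "e < d" for e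
    using not_less_Least[of e "\<lambda>d. d > 0 \<and> z ^ d = 1"] that by (auto simp: d_def)
  have "z ^ n = (z ^ d) ^ (n div d) * z ^ (n mod d)"
    by (metis power_add power_mult mult_div_mod_eq)
  hence "z ^ (n mod d) = 1"
    using zn d by simp
  hence "n mod d = 0"
    using least[of "n mod d"] d by (cases "n mod d = 0") auto
  thus "z \<in> (\<Union>d\<in>{d. d dvd n}. {z. primitive_root_unity d z})"
    using d least by (auto simp: primitive_root_unity_def)
next
  fix z :: complex assume "z \<in> (\<Union>d\<in>{d. d dvd n}. {z. primitive_root_unity d z})"
  thus "z \<in> {z. z ^ n = 1}"
    by (auto simp: primitive_root_unity_def power_mult elim!: dvdE)
qed

lemma finite_primitive_root_unity:
  assumes "n > 0"
  shows "finite {z. primitive_root_unity n z}"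
  by (rule finite_subset[OF _ finite_roots_unity[of n]])
     (use assms in \<open>auto simp: primitive_root_unity_def\<close>)

lemma prod_primitive_root_unity:
  assumes "n > 0"
  shows "(\<Prod>d | d dvd n. \<Prod>z | primitive_root_unity d z. [:- z, 1:]) = monom 1 n - 1"
proof -
  have "d = e" if "primitive_root_unity d z" "primitive_root_unity e z" "d > 0" "e > 0"
    for d e and z :: complex
    using that by (cases d e rule: linorder_cases) (auto simp: primitive_root_unity_def)
  hence "(\<Prod>z\<in>(\<Union>d\<in>{d. d dvd n}. {z. primitive_root_unity d z}). [:- z, 1:]) =
         (\<Prod>d | d dvd n. \<Prod>z | primitive_root_unity d z. [:- z, 1:])"
    using assms dvd_pos_nat[OF assms]
    by (intro prod.UNION_disjoint) (fastforce intro: finite_primitive_root_unity)+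
  thus ?thesis
    using prod_roots_unity[OF assms] by (simp add: roots_unity_partition[OF assms])
qed

lemma ex_cyclotomic:
  assumes "n > 0"
  shows "\<exists>P. map_poly of_int P = (\<Prod>z | primitive_root_unity n z. [:- z, 1:])"
  using assms
proof (induction n rule: less_induct)
  case (less n)
  define C where "C = (\<lambda>n. \<Prod>z | primitive_root_unity n z. [:- z, 1:])"
  have "\<forall>d\<in>{d. d dvd n \<and> d \<noteq> n}. \<exists>P. map_poly of_int P = C d"
    using less unfolding C_def
    by (metis (mono_tags, lifting) dvd_imp_le dvd_pos_nat le_neq_implies_less mem_Collect_eq)
  then obtain F where F: "\<And>d. d dvd n \<Longrightarrow> d \<noteq> n \<Longrightarrow> map_poly of_int (F d) = C d"
    by (metis (mono_tags, lifting) mem_Collect_eq)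
  define D where "D = (\<Prod>d | d dvd n \<and> d \<noteq> n. F d)"
  have D: "map_poly of_int D = (\<Prod>d | d dvd n \<and> d \<noteq> n. C d)"
    unfolding D_def map_poly_of_int_prod by (rule prod.cong) (auto simp: F)
  have "{d. d dvd n} = insert n {d. d dvd n \<and> d \<noteq> n}" "finite {d. d dvd n \<and> d \<noteq> n}"
    using less.prems by auto
  hence split: "monom 1 n - 1 = C n * map_poly of_int D"
    using prod_primitive_root_unity[OF less.prems] by (simp add: D C_def)
  have "lead_coeff (map_poly of_int D :: complex poly) = 1"
    by (simp add: D C_def lead_coeff_prod)
  hence monic: "lead_coeff D = 1"
    by (simp add: degree_map_poly coeff_map_poly)
  hence "D \<noteq> 0"
    by auto
  obtain Q R where QR: "pseudo_divmod (monom 1 n - 1) D = (Q, R)"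
    by force
  have eq: "monom 1 n - 1 = D * Q + R" and deg: "R = 0 \<or> degree R < degree D"
    using pseudo_divmod[OF \<open>D \<noteq> 0\<close> QR] monic by auto
  have "map_poly of_int (monom 1 n - 1 :: int poly) = (monom 1 n - 1 :: complex poly)"
    by (rule poly_eqI) (simp add: coeff_map_poly)
  hence "C n * map_poly of_int D = map_poly of_int D * map_poly of_int Q + map_poly of_int R"
    using split eq by (metis map_poly_of_int_add map_poly_of_int_mult)
  hence R: "map_poly of_int R = map_poly of_int D * (C n - map_poly of_int Q)"
    by (simp add: algebra_simps)
  have "R = 0"
  proof (rule ccontr)
    assume "R \<noteq> 0"
    hence "map_poly of_int R \<noteq> (0 :: complex poly)"
      by (simp add: map_poly_eq_0_iff)
    hence "degree (map_poly of_int D :: complex poly) \<le> degree (map_poly of_int R :: complex poly)"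
      by (intro dvd_imp_degree_le) (simp_all add: R)
    thus False
      using deg \<open>R \<noteq> 0\<close> by (simp add: degree_map_poly)
  qed
  moreover have "map_poly of_int D \<noteq> (0 :: complex poly)"
    using monic by (auto simp: map_poly_eq_0_iff)
  ultimately have "map_poly of_int Q = C n"
    using R by auto
  thus ?case
    unfolding C_def by blast
qed

theorem of_int_cyclotomic:
  assumes "n > 0"
  shows "map_poly of_int (cyclotomic n) = (\<Prod>z | primitive_root_unity n z. [:- z, 1:])"
proof -
  have "\<exists>!P. map_poly of_int P = (\<Prod>z | primitive_root_unity n z. [:- z, 1:])"
    using ex_cyclotomic[OF assms] by (metis map_poly_of_int_inject)
  thus ?thesis
    unfolding cyclotomic_def by (rule theI')
qed

text \<open>
  The upper index is an arbitrary integer. For a negative one the value is only a Laurent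
  polynomial in \<open>q\<close>, so the coefficients are taken in the fraction field of \<open>\<int>[q]\<close>.
\<close>

definition qvar :: "int poly fract" where
  "qvar = to_fract [:0, 1:]"

definition qbinomial :: "int \<Rightarrow> nat \<Rightarrow> int poly fract" where
  "qbinomial N k = (\<Prod>j<k. (1 - qvar powi (N - int j)) / (1 - qvar ^ (j + 1)))"

definition qnumber :: "nat \<Rightarrow> int poly fract" where
  "qnumber n = (1 - qvar ^ n) / (1 - qvar)"

definition qfact :: "nat \<Rightarrow> int poly fract" where
  "qfact n = (\<Prod>j=1..n. qnumber j)"

lemma qvar_power: "qvar ^ n = to_fract (monom 1 n)"
proof (induction n)
  case 0
  show ?case
    by (simp add: monom_0 flip: one_pCons)
next
  case (Suc n)
  have "qvar ^ Suc n = to_fract ([:0, 1:] * monom 1 n)"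
    unfolding to_fract_mult Suc[symmetric] by (simp add: qvar_def)
  thus ?case
    by (simp add: monom_Suc)
qed

lemma qvar_power_neq_1: "n > 0 \<Longrightarrow> qvar ^ n \<noteq> 1"
  unfolding qvar_power
  by (metis degree_1 degree_monom_eq less_irrefl to_fract_1 to_fract_eq_iff zero_neq_one)

lemma qnumber_nonzero: "n > 0 \<Longrightarrow> qnumber n \<noteq> 0"
  using qvar_power_neq_1[of n] qvar_power_neq_1[of 1] by (simp add: qnumber_def)

lemma qbinomial_eq_qfact:
  assumes "k \<le> N"
  shows "qbinomial (int N) k = qfact N / (qfact k * qfact (N - k))"
  using assms
proof (induction k)
  case 0
  have "qfact N \<noteq> 0"
    by (auto simp: qfact_def qnumber_nonzero)
  thus ?case
    by (simp add: qbinomial_def) (simp add: qfact_def)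
next
  case (Suc k)
  have "N - k = Suc (N - Suc k)"
    using Suc.prems by simp
  hence fact_diff: "qfact (N - k) = qfact (N - Suc k) * qnumber (N - k)"
    by (simp add: qfact_def)
  have nz: "qnumber (N - k) \<noteq> 0" "qvar \<noteq> 1"
    using Suc.prems qvar_power_neq_1[of 1] by (simp_all add: qnumber_nonzero)
  have "int N - int k = int (N - k)"
    using Suc.prems by simp
  hence "qbinomial (int N) (Suc k) =
      qbinomial (int N) k * ((1 - qvar ^ (N - k)) / (1 - qvar ^ Suc k))"
    by (simp only: qbinomial_def prod.lessThan_Suc power_int_of_nat flip: Suc_eq_plus1)
  also have "(1 - qvar ^ (N - k)) / (1 - qvar ^ Suc k) = qnumber (N - k) / qnumber (Suc k)"
    using nz by (simp add: qnumber_def)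
  also have "qbinomial (int N) k = qfact N / (qfact k * qfact (N - k))"
    using Suc by simp
  finally show ?case
    using nz by (simp add: fact_diff) (simp add: qfact_def)
qed

lemma qbinomial_eq_0:
  assumes "N < k"
  shows "qbinomial (int N) k = 0"
  using assms unfolding qbinomial_def by (intro prod_zero) (auto intro!: bexI[of _ N])

text \<open>
  \<open>bit r j\<close> is the binary digit of weight \<open>2\<^sup>j\<close> of \<open>r\<close>. For even \<open>a\<close> and \<open>b\<close> the value
  \<open>k_trunc p a b s r\<close> is even and \<open>(a + b) div 2\<close> is an exact quotient.
\<close>

definition k_trunc :: "nat \<Rightarrow> int \<Rightarrow> int \<Rightarrow> nat \<Rightarrow> nat \<Rightarrow> int" where
  "k_trunc p a b s r = (\<Sum>j<s. ((b - a) * of_bool (bit r j) + a) * int p ^ j)"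

definition alpha_trunc :: "nat \<Rightarrow> int \<Rightarrow> int \<Rightarrow> nat \<Rightarrow> int" where
  "alpha_trunc p a b t = (\<Sum>j<t. (a + b) div 2 * int p ^ j)"

end

theory Submission
  imports Defs
begin

text \<open>
  Let \<open>z\<close> be a primitive root of unity of order \<open>d = p ^ m\<close>, and write \<open>A r\<close> for half of
  \<open>k_trunc p a b s r\<close>. By the \<open>q\<close>-Lucas theorem the \<open>r\<close>-th summand at \<open>q = z\<close> splits into a factor
  depending only on \<open>r div 2 ^ m\<close> and a factor depending only on \<open>r mod 2 ^ m\<close>. Complementing
  the lowest \<open>m\<close> binary digits of \<open>r\<close> replaces \<open>A r mod d\<close> by \<open>c - A r mod d\<close>, where \<open>c\<close> is the
  residue of \<open>alpha_trunc p a b t\<close> modulo \<open>d\<close>. The second factor is a \<open>q\<close>-multinomial coefficient that is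
  symmetric under this exchange, whereas the sign \<open>(-1) ^ r\<close> changes; so the sum vanishes at \<open>z\<close>.
\<close>

section \<open>Gaussian binomial coefficients\<close>

text \<open>The q-Pascal recursion serves as definition because it uses only ring operations: it
  makes sense at roots of unity, where the factors in the quotient formula may vanish.\<close>

fun gauss_binomial :: "'a::comm_ring_1 \<Rightarrow> nat \<Rightarrow> nat \<Rightarrow> 'a" where
  "gauss_binomial q n 0 = 1"
| "gauss_binomial q 0 (Suc k) = 0"
| "gauss_binomial q (Suc n) (Suc k) =
     gauss_binomial q n k + q ^ Suc k * gauss_binomial q n (Suc k)"

lemma gauss_binomial_eq_0: "n < k \<Longrightarrow> gauss_binomial q n k = 0"
  by (induction q n k rule: gauss_binomial.induct) auto

lemma gauss_binomial_self [simp]: "gauss_binomial q n n = 1"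
  by (induction n) (auto simp: gauss_binomial_eq_0)

text \<open>The symbol (q;q)_n, a division-free substitute for the q-factorial.\<close>

definition q_pochhammer :: "'a::comm_ring_1 \<Rightarrow> nat \<Rightarrow> 'a" where
  "q_pochhammer q n = (\<Prod>j<n. 1 - q ^ Suc j)"

lemma q_pochhammer_0 [simp]: "q_pochhammer q 0 = 1"
  by (simp add: q_pochhammer_def)

lemma q_pochhammer_Suc: "q_pochhammer q (Suc n) = q_pochhammer q n * (1 - q ^ Suc n)"
  by (simp add: q_pochhammer_def)

text \<open>The factorial formula with denominators cleared, hence valid in every commutative ring.
  Induction on \<open>k + l\<close> reduces it to (1 - q^k) + q^k (1 - q^l) = 1 - q^(k+l).\<close>

lemma gauss_binomial_mult_q_pochhammer:
  "gauss_binomial q (k + l) k * q_pochhammer q k * q_pochhammer q l = q_pochhammer q (k + l)"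
proof (induction "k + l" arbitrary: k l)
  case 0
  then show ?case by simp
next
  case (Suc n)
  consider "k = 0" | "l = 0" | k' l' where "k = Suc k'" "l = Suc l'"
    by (metis not0_implies_Suc)
  then show ?case
  proof cases
    case 3
    have n: "n = k' + Suc l'" "n = Suc k' + l'"
      using Suc.hyps(2) 3 by simp_all
    have IH1: "gauss_binomial q n k' * q_pochhammer q k' * q_pochhammer q (Suc l') = q_pochhammer q n"
      using Suc.hyps(1)[OF n(1)] n(1) by simp
    have IH2: "gauss_binomial q n (Suc k') * q_pochhammer q (Suc k') * q_pochhammer q l' = q_pochhammer q n"
      using Suc.hyps(1)[OF n(2)] n(2) by simp
    have "gauss_binomial q (k + l) k * q_pochhammer q k * q_pochhammer q l =
        (gauss_binomial q n k' * q_pochhammer q k' * q_pochhammer q (Suc l')) * (1 - q ^ Suc k')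
      + (gauss_binomial q n (Suc k') * q_pochhammer q (Suc k') * q_pochhammer q l')
          * (q ^ Suc k' * (1 - q ^ Suc l'))"
      using 3 n by (simp add: q_pochhammer_Suc algebra_simps)
    also have "\<dots> = q_pochhammer q n * (1 - q ^ Suc k' * q ^ Suc l')"
      unfolding IH1 IH2 by (simp add: algebra_simps)
    also have "q ^ Suc k' * q ^ Suc l' = q ^ Suc n"
      by (simp add: n power_add)
    finally show ?thesis
      by (simp only: Suc.hyps(2)[symmetric] q_pochhammer_Suc)
  qed simp_all
qed

section \<open>Transfer to the fraction field and to complex values\<close>

lemma to_fract_gauss_binomial:
  "to_fract (gauss_binomial q n k) = gauss_binomial (to_fract q) n k"
proof -
  have pow: "to_fract (u ^ j) = to_fract u ^ j" for u :: 'a and j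
    by (induction j) simp_all
  show ?thesis
    by (induction q n k rule: gauss_binomial.induct) (simp_all add: pow del: power_Suc)
qed

lemma poly_of_int_gauss_binomial:
  "poly (map_poly of_int (gauss_binomial [:0, 1:] n k)) z = gauss_binomial (z :: complex) n k"
proof -
  have X: "map_poly of_int [:0, 1:] = ([:0, 1:] :: complex poly)"
    by (simp add: map_poly_pCons)
  have pow: "poly (map_poly of_int ([:0, 1:] ^ j)) z = z ^ j" for j
    by (induction j) (simp_all only: power_Suc power_0 map_poly_of_int_mult X poly_mult
        map_poly_1' of_int_1 poly_1, simp)
  show ?thesis
    by (induction "[:0, 1:] :: int poly" n k rule: gauss_binomial.induct)
       (simp_all only: gauss_binomial.simps map_poly_of_int_add map_poly_of_int_mult poly_add
          poly_mult pow map_poly_1' of_int_1 poly_1 map_poly_0 poly_0)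
qed

lemma q_pochhammer_qvar: "q_pochhammer qvar n = (1 - qvar) ^ n * qfact n"
proof (induction n)
  case (Suc n)
  have "1 - qvar \<noteq> 0"
    using qvar_power_neq_1[of 1] by simp
  then have "1 - qvar ^ Suc n = (1 - qvar) * qnumber (Suc n)"
    by (simp add: qnumber_def)
  moreover have "qfact (Suc n) = qfact n * qnumber (Suc n)"
    by (simp add: qfact_def)
  ultimately show ?case
    by (simp only: Suc q_pochhammer_Suc power_Suc mult_ac)
qed (simp add: qfact_def)

text \<open>In the fraction field the powers of \<open>1 - qvar\<close> and the q-factorials are
  nonzero and cancel. With \<open>to_fract_gauss_binomial\<close> this makes
  \<open>qbinomial\<close> with non-negative upper index a polynomial.\<close>

lemma gauss_binomial_qvar: "gauss_binomial qvar n k = qbinomial (int n) k"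
proof (cases "k \<le> n")
  case True
  define l where "l = n - k"
  have n: "n = k + l"
    using True by (simp add: l_def)
  have nz: "qfact j \<noteq> 0" for j
    by (auto simp: qfact_def qnumber_nonzero)
  have "1 - qvar \<noteq> 0"
    using qvar_power_neq_1[of 1] by simp
  then have "gauss_binomial qvar (k + l) k * qfact k * qfact l = qfact (k + l)"
    using gauss_binomial_mult_q_pochhammer[of qvar k l]
    by (simp add: q_pochhammer_qvar power_add)
  then show ?thesis
    unfolding qbinomial_eq_qfact[OF True] using nz by (simp add: l_def[symmetric] flip: n)
      (simp add: field_simps)
qed (simp add: gauss_binomial_eq_0 qbinomial_eq_0)

section \<open>Evaluation at roots of unity\<close>

lemma q_pochhammer_root_unity_nonzero:
  assumes "primitive_root_unity d z" "n < d"
  shows "q_pochhammer z n \<noteq> 0"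
  using assms by (auto simp: q_pochhammer_def primitive_root_unity_def simp del: power_Suc)

text \<open>\<open>q_pochhammer z d\<close> contains the zero factor \<open>1 - z ^ d\<close>,
  whereas the two shorter products have no zero factor.\<close>

lemma gauss_binomial_root_unity_eq_0:
  assumes z: "primitive_root_unity d z" and k: "0 < k" "k < d"
  shows "gauss_binomial z d k = 0"
proof -
  have "gauss_binomial z d k * q_pochhammer z k * q_pochhammer z (d - k) = q_pochhammer z d"
    using gauss_binomial_mult_q_pochhammer[of z k "d - k"] k by simp
  also have "q_pochhammer z d = 0"
    using z k by (cases d) (simp_all add: q_pochhammer_Suc primitive_root_unity_def)
  finally show ?thesis
    using q_pochhammer_root_unity_nonzero[OF z] k by simp
qed

text \<open>Induction on \<open>n\<close> by the q-Pascal rule. Passing to the successor either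
  raises a residue modulo \<open>d\<close> by one or wraps it to 0 and raises the quotient; the
  cases record which of the two indices wraps.\<close>

theorem q_lucas:
  assumes z: "primitive_root_unity d z" and d: "d > 1"
  shows "gauss_binomial z n k =
    of_nat ((n div d) choose (k div d)) * gauss_binomial z (n mod d) (k mod d)"
proof (induction n arbitrary: k)
  case 0
  show ?case
  proof (cases "k mod d")
    case 0
    then show ?thesis
      using d by (cases "k = 0"; cases k; cases "k div d") (auto dest: dvd_imp_le)
  next
    case (Suc j)
    then show ?thesis
      by (cases k) simp_all
  qed
next
  case (Suc n)
  show ?case
  proof (cases k)
    case (Suc j)
    have zd: "z ^ d = 1"
      using z by (simp add: primitive_root_unity_def)
    have rec: "gauss_binomial z (Suc n) k =
        of_nat ((n div d) choose (j div d)) * gauss_binomial z (n mod d) (j mod d)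
      + z ^ Suc j * (of_nat ((n div d) choose (Suc j div d)) * gauss_binomial z (n mod d) (Suc j mod d))"
      using Suc.IH[of j] Suc.IH[of "Suc j"] by (simp only: Suc gauss_binomial.simps)
    show ?thesis
    proof (cases "Suc (j mod d) = d")
      case True
      have jd: "Suc j mod d = 0" "Suc j div d = Suc (j div d)"
        using True by (simp_all add: mod_Suc div_Suc)
      have "z ^ Suc j = (z ^ d) ^ (Suc j div d)"
        using jd(1) by (metis dvd_mult_div_cancel mod_eq_0_iff_dvd power_mult)
      then have zj: "z ^ Suc j = 1"
        using zd by simp
      show ?thesis
      proof (cases "Suc (n mod d) = d")
        \<comment> \<open>Both indices wrap: the recursion becomes Pascal's rule for the ordinary
          binomials.\<close>
        case n: True
        have "n mod d = j mod d"
          using True n by simp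
        then show ?thesis
          unfolding rec unfolding Suc zj jd using n by (simp add: mod_Suc div_Suc)
      next
        \<comment> \<open>Only the lower index wraps: \<open>j mod d\<close> is maximal and exceeds
          \<open>n mod d\<close>, so the first term vanishes.\<close>
        case n: False
        have "n mod d < d"
          using d by simp
        then have "n mod d < j mod d"
          using True n by linarith
        then have "gauss_binomial z (n mod d) (j mod d) = 0"
          by (rule gauss_binomial_eq_0)
        then show ?thesis
          unfolding rec unfolding Suc zj jd using n by (simp add: mod_Suc div_Suc)
      qed
    next
      case False
      have jd: "Suc j mod d = Suc (j mod d)" "Suc j div d = j div d"
        using False by (simp_all add: mod_Suc div_Suc)
      have "z ^ Suc j = (z ^ d) ^ (Suc j div d) * z ^ (Suc j mod d)"
        by (metis mult_div_mod_eq power_add power_mult)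
      then have zj: "z ^ Suc j = z ^ Suc (j mod d)"
        using zd jd(1) by simp
      have "gauss_binomial z (Suc n) k =
          of_nat ((n div d) choose (j div d)) * gauss_binomial z (Suc (n mod d)) (Suc (j mod d))"
        unfolding rec zj jd by (simp add: algebra_simps)
      \<comment> \<open>If only the upper index wraps, the q-binomial is an interior entry of row
        \<open>d\<close>, which is zero at \<open>z\<close>.\<close>
      moreover have "gauss_binomial z (Suc (n mod d)) (Suc (j mod d)) = 0"
        if "Suc (n mod d) = d"
      proof -
        have "j mod d < d"
          using d by simp
        then have "Suc (j mod d) < d"
          using False by linarith
        then show ?thesis
          unfolding that by (intro gauss_binomial_root_unity_eq_0[OF z]) auto
      qed
      ultimately show ?thesis
        unfolding Suc jd by (auto simp: mod_Suc div_Suc simp del: gauss_binomial.simps(3))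
    qed
  qed simp
qed

section \<open>Symmetry of the q-trinomial product\<close>

text \<open>With x = i + u and y = i + v both sides are (q;q)_(i+u+v) / ((q;q)_i (q;q)_u (q;q)_v) at
  q = z, symmetric in u and v. The bound \<open>x + y < d\<close> keeps the cancelled factors
  nonzero.\<close>

lemma gauss_trinomial_symmetric:
  assumes z: "primitive_root_unity d z" and "x + y < d"
  shows "gauss_binomial z x i * gauss_binomial z (x + y - i) x =
         gauss_binomial z y i * gauss_binomial z (x + y - i) y"
proof (cases "i \<le> x \<and> i \<le> y")
  case True
  then obtain u v where uv: "x = i + u" "y = i + v"
    by (metis le_Suc_ex)
  let ?P = "q_pochhammer z"
  have nz: "?P i \<noteq> 0" "?P u \<noteq> 0" "?P v \<noteq> 0" "?P (i + u) \<noteq> 0" "?P (i + v) \<noteq> 0"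
    by (rule q_pochhammer_root_unity_nonzero[OF z], use assms uv in simp)+
  have 1: "gauss_binomial z (i + u) i * ?P i * ?P u = ?P (i + u)"
    and 2: "gauss_binomial z (i + v) i * ?P i * ?P v = ?P (i + v)"
    and 3: "gauss_binomial z (i + u + v) (i + u) * ?P (i + u) * ?P v = ?P (i + u + v)"
    using gauss_binomial_mult_q_pochhammer by blast+
  have "gauss_binomial z (i + v + u) (i + v) * ?P (i + v) * ?P u = ?P (i + v + u)"
    using gauss_binomial_mult_q_pochhammer by blast
  then have 4: "gauss_binomial z (i + u + v) (i + v) * ?P (i + v) * ?P u = ?P (i + u + v)"
    by (simp add: add_ac)
  have "(gauss_binomial z (i + u) i * gauss_binomial z (i + u + v) (i + u)) * (?P i * ?P u * ?P v) =
        (gauss_binomial z (i + u) i * ?P i * ?P u) * gauss_binomial z (i + u + v) (i + u) * ?P v"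
    by (simp add: mult_ac)
  also have "\<dots> = ?P (i + u + v)"
    unfolding 1 3[symmetric] by (simp add: mult_ac)
  also have "\<dots> = (gauss_binomial z (i + v) i * ?P i * ?P v) * gauss_binomial z (i + u + v) (i + v) * ?P u"
    unfolding 2 4[symmetric] by (simp add: mult_ac)
  also have "\<dots> = (gauss_binomial z (i + v) i * gauss_binomial z (i + u + v) (i + v)) * (?P i * ?P u * ?P v)"
    by (simp add: mult_ac)
  finally have "gauss_binomial z (i + u) i * gauss_binomial z (i + u + v) (i + u) =
        gauss_binomial z (i + v) i * gauss_binomial z (i + u + v) (i + v)"
    using nz by simp
  moreover have "x + y - i = i + u + v"
    using uv by simp
  ultimately show ?thesis
    using uv by (simp only:)
next
  case False
  \<comment> \<open>In each case both sides contain a q-binomial whose lower index exceeds its upper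
    one.\<close>
  then consider "x < i" "y < i" | "x < i" "x + y - i < y" | "y < i" "x + y - i < x"
    by linarith
  then show ?thesis
    by cases (simp_all add: gauss_binomial_eq_0)
qed

text \<open>By \<open>q_lucas\<close> the quotients modulo \<open>d\<close> contribute ordinary
  binomials that agree on both sides, and the residues reduce to
  \<open>gauss_trinomial_symmetric\<close>.\<close>

lemma gauss_trinomial_symmetric_mod:
  assumes z: "primitive_root_unity d z" and d: "d > 1"
    and xy: "x + y < d" and i: "i \<le> x + y + d * w"
  shows "gauss_binomial z (x + d * u) i * gauss_binomial z (x + y + d * w - i) (x + d * u) =
         gauss_binomial z (y + d * u) i * gauss_binomial z (x + y + d * w - i) (y + d * u)"
proof -
  have lower: "gauss_binomial z (v + d * u) i =
      of_nat (u choose (i div d)) * gauss_binomial z v (i mod d)" if "v < d" for v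
    using that d by (subst q_lucas[OF z d]) simp
  show ?thesis
  proof (cases "i mod d \<le> x + y")
    case True
    \<comment> \<open>No borrow occurs when \<open>i\<close> is subtracted, so quotients and
      residues subtract separately.\<close>
    have "i div d \<le> w"
      using div_le_mono[OF i, of d] xy d by simp
    then have "x + y + d * w - i = (x + y - i mod d) + d * (w - i div d)"
      using True mult_div_mod_eq[of d i] mult_le_mono2[of "i div d" w d]
      by (simp add: diff_mult_distrib2)
    moreover have "x + y - i mod d < d"
      using xy by linarith
    ultimately have upper: "gauss_binomial z (x + y + d * w - i) (v + d * u) =
        of_nat ((w - i div d) choose u) * gauss_binomial z (x + y - i mod d) v" if "v < d" for v
      using that d by (subst q_lucas[OF z d]) simp
    have "x < d" "y < d"
      using xy by simp_all
    then show ?thesis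
      using gauss_trinomial_symmetric[OF z xy, of "i mod d"] by (simp add: lower upper)
  next
    case False
    \<comment> \<open>Here \<open>i mod d\<close> exceeds both \<open>x\<close> and
      \<open>y\<close>, so the first factor vanishes on both sides.\<close>
    then show ?thesis
      using xy by (simp add: lower gauss_binomial_eq_0)
  qed
qed

section \<open>Divisibility by cyclotomic polynomials\<close>

lemma prod_linear_dvd:
  fixes P :: "'a::field poly"
  assumes "finite A" "\<And>z. z \<in> A \<Longrightarrow> poly P z = 0"
  shows "(\<Prod>z\<in>A. [:- z, 1:]) dvd P"
  using assms
proof (induction A rule: finite_induct)
  case (insert x A)
  then obtain Q where Q: "P = (\<Prod>z\<in>A. [:- z, 1:]) * Q"
    by (auto elim!: dvdE)
  have "poly (\<Prod>z\<in>A. [:- z, 1:]) x \<noteq> 0"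
    using insert.hyps by (auto simp: poly_prod)
  then have "poly Q x = 0"
    using insert.prems[of x] Q by simp
  then have "[:- x, 1:] dvd Q"
    by (simp add: poly_eq_0_iff_dvd)
  then show ?case
    unfolding Q prod.insert[OF insert.hyps] by (subst mult.commute) (rule mult_dvd_mono[OF dvd_refl])
qed simp

text \<open>Division by a monic polynomial stays in integer coefficients. The remainder is still a
  complex multiple of \<open>D\<close>, so its smaller degree forces it to be 0.\<close>

lemma monic_dvd_if_of_int_dvd:
  fixes D P :: "int poly"
  assumes monic: "lead_coeff D = 1"
    and dvd: "map_poly of_int D dvd (map_poly of_int P :: complex poly)"
  shows "D dvd P"
proof -
  have "D \<noteq> 0"
    using monic by auto
  obtain Q R where QR: "pseudo_divmod P D = (Q, R)"
    by force
  have eq: "P = D * Q + R" and deg: "R = 0 \<or> degree R < degree D"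
    using pseudo_divmod[OF \<open>D \<noteq> 0\<close> QR] monic by auto
  have "map_poly of_int D dvd (map_poly of_int R :: complex poly)"
    using dvd unfolding eq map_poly_of_int_add map_poly_of_int_mult
    by (simp add: dvd_add_right_iff)
  moreover have "degree (map_poly of_int F :: complex poly) = degree F" for F :: "int poly"
    by (simp add: degree_map_poly)
  moreover have "map_poly of_int R \<noteq> (0 :: complex poly)" if "R \<noteq> 0"
    using that by (simp add: map_poly_eq_0_iff)
  ultimately have "R = 0"
    using deg dvd_imp_degree_le[of "map_poly of_int D" "map_poly of_int R :: complex poly"]
    by (metis not_less)
  then show ?thesis
    using eq by simp
qed

text \<open>Over the complex numbers the cyclotomic polynomial is a product of distinct linear
  factors; being monic, it also divides over the integers.\<close>

lemma cyclotomic_dvd_if_roots: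
  assumes "n > 0" "\<And>z. primitive_root_unity n z \<Longrightarrow> poly (map_poly of_int P) z = 0"
  shows "cyclotomic n dvd P"
proof (rule monic_dvd_if_of_int_dvd)
  have "lead_coeff (map_poly of_int (cyclotomic n) :: complex poly) = 1"
    by (simp add: of_int_cyclotomic assms lead_coeff_prod)
  then show "lead_coeff (cyclotomic n) = 1"
    by (simp add: degree_map_poly coeff_map_poly)
  show "map_poly of_int (cyclotomic n) dvd (map_poly of_int P :: complex poly)"
    using assms by (auto simp: of_int_cyclotomic intro!: prod_linear_dvd finite_primitive_root_unity)
qed

section \<open>Digit sums\<close>

text \<open>With \<open>x\<close> and \<open>y\<close> the halves of \<open>a\<close> and
  \<open>b\<close> this is half of \<open>k_trunc\<close>, kept in \<open>nat\<close>. Taking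
  \<open>x + y\<close> for both digits gives \<open>alpha_trunc\<close>.\<close>

definition digit_sum :: "nat \<Rightarrow> nat \<Rightarrow> nat \<Rightarrow> nat \<Rightarrow> nat \<Rightarrow> nat" where
  "digit_sum p x y s r = (\<Sum>j<s. (if bit r j then y else x) * p ^ j)"

lemma digit_sum_add:
  "digit_sum p x y (m + l) r = digit_sum p x y m r + p ^ m * digit_sum p x y l (r div 2 ^ m)"
proof -
  have "bit (r div 2 ^ m) j \<longleftrightarrow> bit r (m + j)" for j
    by (simp add: bit_drop_bit_eq flip: drop_bit_eq_div)
  then show ?thesis
    by (induction l) (simp_all add: digit_sum_def power_add algebra_simps)
qed

lemma digit_sum_mod: "digit_sum p x y m (r mod 2 ^ m) = digit_sum p x y m r"
  by (auto simp: digit_sum_def bit_take_bit_iff simp flip: take_bit_eq_mod intro!: sum.cong)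

lemma digit_sum_const: "digit_sum p x x s r = (\<Sum>j<s. x * p ^ j)"
  by (simp add: digit_sum_def)

lemma digit_sum_less:
  assumes "x < p" "y < p"
  shows "digit_sum p x y s r < p ^ s"
proof (induction s)
  case (Suc s)
  have "(if bit r s then y else x) \<le> p - 1"
    using assms by auto
  then have "(if bit r s then y else x) * p ^ s \<le> (p - 1) * p ^ s"
    by (rule mult_right_mono) simp
  then have "digit_sum p x y (Suc s) r < p ^ s + (p - 1) * p ^ s"
    using Suc unfolding digit_sum_def sum.lessThan_Suc by linarith
  also have "\<dots> = p ^ Suc s"
    using assms by (cases p) simp_all
  finally show ?case .
qed (simp add: digit_sum_def)

text \<open>Subtraction from \<open>2 ^ m - 1\<close> flips every bit, so each position receives
  \<open>x\<close> once and \<open>y\<close> once. The induction peels off the lowest bit.\<close>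

lemma digit_sum_complement:
  "r < 2 ^ m \<Longrightarrow>
    digit_sum p x y m r + digit_sum p x y m (2 ^ m - 1 - r) = (\<Sum>j<m. (x + y) * p ^ j)"
proof (induction m arbitrary: r)
  case (Suc m)
  define r' where "r' = 2 ^ Suc m - 1 - r"
  have step: "digit_sum p x y (Suc m) u =
      (if odd u then y else x) + p * digit_sum p x y m (u div 2)" for u
    using digit_sum_add[of p x y 1 m u] by (simp add: digit_sum_def bit_0)
  have div: "r div 2 < 2 ^ m" "r' div 2 = 2 ^ m - 1 - r div 2"
    using Suc.prems unfolding r'_def by auto
  have par: "odd r' \<longleftrightarrow> even r"
    using Suc.prems unfolding r'_def by simp
  have "(\<Sum>j<Suc m. (x + y) * p ^ j) = (x + y) + p * (\<Sum>j<m. (x + y) * p ^ j)"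
    by (simp add: sum.lessThan_Suc_shift sum_distrib_left algebra_simps del: sum.lessThan_Suc)
  then show ?case
    using Suc.IH[OF div(1)] par unfolding r'_def[symmetric] step div(2)
    by (auto simp flip: distrib_left)
qed (simp add: digit_sum_def)

lemma k_trunc_eq_digit_sum:
  "k_trunc p (2 * int x) (2 * int y) s r div 2 = int (digit_sum p x y s r)"
proof -
  have "k_trunc p (2 * int x) (2 * int y) s r = 2 * int (digit_sum p x y s r)"
    unfolding k_trunc_def digit_sum_def of_nat_sum sum_distrib_left
    by (rule sum.cong) (auto simp: algebra_simps)
  then show ?thesis
    by simp
qed

lemma alpha_trunc_eq_sum:
  "alpha_trunc p (2 * int x) (2 * int y) t = int (\<Sum>j<t. (x + y) * p ^ j)"
proof -
  have "(2 * int x + 2 * int y) div 2 = int (x + y)"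
    by simp
  then show ?thesis
    by (simp add: alpha_trunc_def)
qed

section \<open>The sign-reversing involution\<close>

text \<open>Complements the lowest \<open>m\<close> bits; the arithmetic form exposes quotient and
  remainder modulo \<open>2 ^ m\<close>.\<close>

definition flip_low_bits :: "nat \<Rightarrow> nat \<Rightarrow> nat" where
  "flip_low_bits m r = (2 ^ m - 1 - r mod 2 ^ m) + 2 ^ m * (r div 2 ^ m)"

lemma flip_low_bits_div_mod:
  "flip_low_bits m r div 2 ^ m = r div 2 ^ m"
  "flip_low_bits m r mod 2 ^ m = 2 ^ m - 1 - r mod 2 ^ m"
proof -
  have "2 ^ m - 1 - r mod 2 ^ m < (2 ^ m :: nat)"
    by (meson diff_le_self less_le_trans diff_less le_less_trans zero_less_numeral zero_less_power zero_less_one)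
  then show "flip_low_bits m r div 2 ^ m = r div 2 ^ m"
    "flip_low_bits m r mod 2 ^ m = 2 ^ m - 1 - r mod 2 ^ m"
    by (simp_all add: flip_low_bits_def)
qed

lemma flip_low_bits_flip_low_bits: "flip_low_bits m (flip_low_bits m r) = r"
proof -
  have "r mod 2 ^ m < 2 ^ m"
    by simp
  then have "r mod 2 ^ m \<le> 2 ^ m - 1"
    by linarith
  then have "2 ^ m - 1 - (2 ^ m - 1 - r mod 2 ^ m) = r mod 2 ^ m"
    by simp
  then show ?thesis
    unfolding flip_low_bits_def[of m "flip_low_bits m r"] flip_low_bits_div_mod by simp
qed

lemma flip_low_bits_less:
  assumes "r < 2 ^ n" "m \<le> n"
  shows "flip_low_bits m r < 2 ^ n"
proof -
  have n: "2 ^ n = 2 ^ (n - m) * (2 ^ m :: nat)"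
    using assms by (simp flip: power_add)
  have "r div 2 ^ m < 2 ^ (n - m)"
    using assms unfolding n by (simp add: less_mult_imp_div_less)
  then have "flip_low_bits m r div 2 ^ m < 2 ^ (n - m)"
    by (simp add: flip_low_bits_div_mod)
  then show ?thesis
    unfolding n by (simp add: div_less_iff_less_mult)
qed

text \<open>Since \<open>m > 0\<close>, bit 0 is among the flipped ones; this produces the sign
  change.\<close>

lemma even_flip_low_bits:
  assumes "m > 0"
  shows "even (flip_low_bits m r) \<longleftrightarrow> odd r"
proof -
  have "Suc (r mod 2 ^ m) \<le> 2 ^ m"
    by (simp add: Suc_le_eq)
  then have "even (2 ^ m - 1 - r mod 2 ^ m) \<longleftrightarrow> odd (r mod 2 ^ m)"
    using assms by simp
  moreover have "even (r mod 2 ^ m) \<longleftrightarrow> even r"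
    using assms by (simp add: dvd_mod_iff)
  ultimately show ?thesis
    using assms by (simp add: flip_low_bits_def)
qed

text \<open>Reindexing by \<open>flip_low_bits m\<close> turns the sum into its own negative. The
  index range is preserved because \<open>m\<close> is at most \<open>n\<close>, and
  \<open>m\<close> low digits can be split off because \<open>m\<close> is at most \<open>s\<close>
  and \<open>t\<close>.\<close>

lemma alternating_sum_root_unity_eq_0:
  assumes z: "primitive_root_unity (p ^ m) z" and p: "p > 1" and xy: "x + y < p"
    and m: "0 < m" "m \<le> n" "n \<le> s" "s \<le> t"
    and T: "T = (\<Sum>j<t. (x + y) * p ^ j)" and i: "i \<le> T"
  shows "(\<Sum>r<2 ^ n. (-1) ^ r * gauss_binomial z (digit_sum p x y s r) i
           * gauss_binomial z (T - i) (digit_sum p x y s r)) = 0"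
    (is "sum ?F _ = 0")
proof -
  let ?D = "digit_sum p x y"
  have d: "p ^ m > 1"
    by (rule one_less_power[OF p m(1)])
  \<comment> \<open>The quotient of \<open>T\<close> by \<open>p ^ m\<close>; any bit pattern may
    replace \<open>0\<close>, as both digit values coincide.\<close>
  define w where "w = digit_sum p (x + y) (x + y) (t - m) 0"
  have split_T: "T = (\<Sum>j<m. (x + y) * p ^ j) + p ^ m * w"
    using digit_sum_add[of p "x + y" "x + y" m "t - m" 0] m
    by (simp add: T w_def digit_sum_const)
  \<comment> \<open>As \<open>x + y < p\<close>, the low part of \<open>T\<close> is its residue
    modulo \<open>p ^ m\<close>.\<close>
  have small: "(\<Sum>j<m. (x + y) * p ^ j) < p ^ m"
    using digit_sum_less[OF xy xy, of m 0] by (simp add: digit_sum_const)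
  have flip: "?F (flip_low_bits m r) = - ?F r" for r
  proof -
    let ?r = "r mod 2 ^ m"
    \<comment> \<open>The flip leaves the bits from \<open>m\<close> upwards alone, so
      \<open>r\<close> and its image share this \<open>u\<close>.\<close>
    define u where "u = ?D (s - m) (r div 2 ^ m)"
    have D: "?D s v = ?D m (v mod 2 ^ m) + p ^ m * ?D (s - m) (v div 2 ^ m)" for v
      using digit_sum_add[of p x y m "s - m" v] m by (simp add: digit_sum_mod)
    define x' where "x' = ?D m ?r"
    define y' where "y' = ?D m (2 ^ m - 1 - ?r)"
    have xy': "x' + y' = (\<Sum>j<m. (x + y) * p ^ j)"
      unfolding x'_def y'_def by (rule digit_sum_complement) simp
    have Dr: "?D s r = x' + p ^ m * u" "?D s (flip_low_bits m r) = y' + p ^ m * u"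
      by (simp_all add: D[of r] D[of "flip_low_bits m r"] flip_low_bits_div_mod u_def x'_def y'_def)
    have Txy: "T = x' + y' + p ^ m * w"
      using split_T xy' by simp
    have "gauss_binomial z (?D s r) i * gauss_binomial z (T - i) (?D s r) =
        gauss_binomial z (?D s (flip_low_bits m r)) i
          * gauss_binomial z (T - i) (?D s (flip_low_bits m r))"
      unfolding Dr Txy
      by (rule gauss_trinomial_symmetric_mod[OF z d]) (use small xy' i Txy in auto)
    moreover have "(-1) ^ flip_low_bits m r = - ((-1) ^ r :: complex)"
      using even_flip_low_bits[OF m(1), of r] by (cases "even r") simp_all
    ultimately show ?thesis
      by (simp add: mult.assoc)
  qed
  have "sum ?F {..<2 ^ n} = (\<Sum>r<2 ^ n. ?F (flip_low_bits m r))"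
    by (rule sum.reindex_bij_witness[of _ "flip_low_bits m" "flip_low_bits m"])
       (use m in \<open>auto simp: flip_low_bits_flip_low_bits flip_low_bits_less\<close>)
  also have "\<dots> = - sum ?F {..<2 ^ n}"
    unfolding flip by (rule sum_negf)
  finally show ?thesis
    by simp
qed

theorem theorem2p4:
  fixes p n m s t i :: nat and a b :: int
  assumes "prime p" and "p > 2" and "n > 0"
    and "even a" and "even b" and "0 \<le> a" and "a < b" and "b \<le> int p - 1"
    and "1 \<le> m" and "m \<le> n" and "n \<le> s" and "s \<le> t"
  shows "\<exists>S :: int poly.
    to_fract S =
      (\<Sum>r<2 ^ n. (-1) ^ r * qbinomial (k_trunc p a b s r div 2) i
         * qbinomial (alpha_trunc p a b t - int i) (nat (k_trunc p a b s r div 2)))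
    \<and> cyclotomic (p ^ m) dvd S"
proof -
  define x y where "x = nat (a div 2)" and "y = nat (b div 2)"
  have ab: "a = 2 * int x" "b = 2 * int y"
    using assms by (auto simp: x_def y_def)
  \<comment> \<open>From \<open>a < b\<close> and \<open>b < p\<close> the mean of \<open>a\<close>
    and \<open>b\<close> is below \<open>p\<close>, a genuine base-\<open>p\<close> digit.\<close>
  have xy: "x + y < p"
    using assms unfolding ab by linarith
  define D where "D = digit_sum p x y s"
  define T where "T = (\<Sum>j<t. (x + y) * p ^ j)"
  have k: "k_trunc p a b s r div 2 = int (D r)" for r
    unfolding ab D_def by (rule k_trunc_eq_digit_sum)
  have al: "alpha_trunc p a b t = int T"
    unfolding ab T_def by (rule alpha_trunc_eq_sum)
  show ?thesis
  proof (cases "i \<le> T")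
    case True
    \<comment> \<open>All upper indices are now non-negative, so every q-binomial lifts to an
      integer polynomial.\<close>
    define g :: "nat \<Rightarrow> nat \<Rightarrow> int poly" where "g = gauss_binomial [:0, 1:]"
    have g: "qbinomial (int N) j = to_fract (g N j)" for N j
      by (simp add: g_def to_fract_gauss_binomial gauss_binomial_qvar flip: qvar_def)
    define F where "F = (\<lambda>r. (-1) ^ r * g (D r) i * g (T - i) (D r))"
    have sgn: "(-1) ^ r = (to_fract ((-1) ^ r) :: int poly fract)" for r
      by (cases "even r") simp_all
    have "to_fract (\<Sum>r<2 ^ n. F r) =
        (\<Sum>r<2 ^ n. (-1) ^ r * qbinomial (k_trunc p a b s r div 2) i
         * qbinomial (alpha_trunc p a b t - int i) (nat (k_trunc p a b s r div 2)))"
      using True unfolding k al F_def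
      by (simp add: to_fract_sum sgn g flip: of_nat_diff)
    moreover have "cyclotomic (p ^ m) dvd (\<Sum>r<2 ^ n. F r)"
    proof (rule cyclotomic_dvd_if_roots)
      fix z assume z: "primitive_root_unity (p ^ m) z"
      have add: "poly (map_poly of_int (sum h A)) z = (\<Sum>r\<in>A. poly (map_poly of_int (h r)) z)"
        for h :: "nat \<Rightarrow> int poly" and A
        by (induction A rule: infinite_finite_induct) (simp_all add: map_poly_of_int_add)
      have "map_poly of_int (-1 :: int poly) = (-1 :: complex poly)"
        by (rule poly_eqI) (simp add: coeff_map_poly)
      then have "poly (map_poly of_int ((-1) ^ r)) z = (-1) ^ r" for r
        by (cases "even r") simp_all
      then have "poly (map_poly of_int (\<Sum>r<2 ^ n. F r)) z =
          (\<Sum>r<2 ^ n. (-1) ^ r * gauss_binomial z (D r) i * gauss_binomial z (T - i) (D r))"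
        by (simp add: add F_def g_def map_poly_of_int_mult poly_of_int_gauss_binomial)
      also have "\<dots> = 0"
        unfolding D_def
        by (rule alternating_sum_root_unity_eq_0[OF z _ xy]) (use assms True in \<open>simp_all add: T_def\<close>)
      finally show "poly (map_poly of_int (\<Sum>r<2 ^ n. F r)) z = 0" .
    qed (use assms in simp)
    ultimately show ?thesis
      by blast
  next
    case False \<comment> \<open>the upper index \<open>T - i\<close> is negative, but every first factor vanishes\<close>
    have "D r < i" for r
    proof -
      have "D r \<le> T"
      proof -
        \<comment> \<open>Each digit is \<open>x\<close> or \<open>y\<close>, hence at most
          \<open>x + y\<close>; the remaining terms of \<open>T\<close> are non-negative.\<close>
        have "D r \<le> (\<Sum>j<s. (x + y) * p ^ j)"
          unfolding D_def digit_sum_def by (intro sum_mono mult_right_mono) auto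
        also have "\<dots> \<le> T"
          unfolding T_def using \<open>s \<le> t\<close> by (intro sum_mono2) auto
        finally show ?thesis .
      qed
      then show ?thesis
        using False by simp
    qed
    then show ?thesis
      by (intro exI[of _ 0]) (simp add: k qbinomial_eq_0)
  qed
qed

end
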